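(* Let $k\in\mathbb{N}$, let $d$ be the metric on $\mathbb{R}^k$ induced by a norm $\|\cdot\|$, let $r\in(0,\infty)$, let $S$ be a nonempty closed subset of $\mathbb{R}^k$, and let $P$ be a Borel probability measure on $\mathbb{R}^k$ with $\int d(x,0)^r\,dP(x)<\infty$. Then, for every $n\in\mathbb{N}$, the $n$th constrained quantization error $V_{n,r}(P)$ with respect to $S$ exists, and $(V_{n,r}(P))_{n\ge 1}$ is a decreasing sequence of finite nonnegative numbers.
   Context: For a locally finite set $\alpha\subseteq S$ (one whose intersection with every bounded subset of $\mathbb{R}^k$ is finite), the distortion error of order $r$ is $V_r(P;\alpha)=\int \min_{a\in\alpha} d(x,a)^r\,dP(x)$. The $n$th constrained quantization error of order $r$ with respect to the constraint $S$ is $$V_{n,r}(P)=\inf\{V_r(P;\alpha):\alpha\subseteq S,\ 1\le \mathrm{card}(\alpha)\le n\}.$$ "Decreasing" is meant in the weak sense: $V_{m,r}(P)\le V_{n,r}(P)$ whenever $m>n$. *)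

theory Defs
  imports "HOL-Probability.Probability"
begin

definition is_norm :: "('a::real_vector \<Rightarrow> real) \<Rightarrow> bool" where
  "is_norm N \<longleftrightarrow>
     (\<forall>x. 0 \<le> N x) \<and>
     (\<forall>x. N x = 0 \<longleftrightarrow> x = 0) \<and>
     (\<forall>c x. N (c *\<^sub>R x) = \<bar>c\<bar> * N x) \<and>
     (\<forall>x y. N (x + y) \<le> N x + N y)"

definition induced_metric :: "('a::real_vector \<Rightarrow> real) \<Rightarrow> 'a \<Rightarrow> 'a \<Rightarrow> real" where
  "induced_metric N x y = N (x - y)"

(* The minimum of d(x,a)^r over a in \<alpha>, literally as a least element: it is meaningful
   whenever that minimum is attained, in particular for every finite nonempty \<alpha>. *)
definition min_cost :: "('a \<Rightarrow> 'a \<Rightarrow> real) \<Rightarrow> real \<Rightarrow> 'a set \<Rightarrow> 'a \<Rightarrow> real" where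
  "min_cost d r \<alpha> x = (LEAST t. t \<in> (\<lambda>a. d x a powr r) ` \<alpha>)"

(* The integrand is nonnegative, so the integral is taken in [0, \<infinity>]; an infinite error is
   thus recorded as \<infinity> instead of the default value of a non-integrable function. *)
definition distortion_error ::
    "('a \<Rightarrow> 'a \<Rightarrow> real) \<Rightarrow> real \<Rightarrow> 'a measure \<Rightarrow> 'a set \<Rightarrow> ennreal" where
  "distortion_error d r P \<alpha> = (\<integral>\<^sup>+ x. ennreal (min_cost d r \<alpha> x) \<partial>P)"

(* An infinite set has card 0 and is therefore excluded by the lower bound. *)
definition competitors :: "'a set \<Rightarrow> nat \<Rightarrow> 'a set set" where
  "competitors S n = {\<alpha>. \<alpha> \<subseteq> S \<and> 1 \<le> card \<alpha> \<and> card \<alpha> \<le> n}"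

definition constrained_quantization_error ::
    "('a \<Rightarrow> 'a \<Rightarrow> real) \<Rightarrow> real \<Rightarrow> 'a set \<Rightarrow> 'a measure \<Rightarrow> nat \<Rightarrow> ennreal" where
  "constrained_quantization_error d r S P n =
     (INF \<alpha>\<in>competitors S n. distortion_error d r P \<alpha>)"

(* Every subset of [0, \<infinity>] has an infimum in ennreal, so existence of the error is made explicit:
   the infimum is over a nonempty family, and for each member the minimum in the
   integrand is attained at every point and the integrand is measurable. *)
definition constrained_quantization_error_exists ::
    "('a \<Rightarrow> 'a \<Rightarrow> real) \<Rightarrow> real \<Rightarrow> 'a set \<Rightarrow> 'a measure \<Rightarrow> nat \<Rightarrow> bool" where
  "constrained_quantization_error_exists d r S P n \<longleftrightarrow>
     competitors S n \<noteq> {} \<and>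
     (\<forall>\<alpha>\<in>competitors S n.
        (\<forall>x. \<exists>a\<in>\<alpha>. \<forall>b\<in>\<alpha>. d x a powr r \<le> d x b powr r) \<and>
        min_cost d r \<alpha> \<in> borel_measurable P)"

end

theory Submission
  imports Defs
begin

text \<open>A competitor is a finite nonempty set, so the minimum in the integrand is attained, and
  it is Borel measurable as a finite minimum of functions \<open>d x a powr r\<close>, which are
  measurable because every norm on a finite-dimensional space is continuous
  (\<open>is_norm_continuous\<close>). With S nonempty, singletons make the family of competitors
  nonempty, so the error exists. Raising n enlarges the family, hence the infimum can only drop. For
  finiteness one competitor {a} with a in S is enough: the triangle inequality and
  \<open>add_powr_le\<close> bound its cost by a multiple of \<open>N x powr r\<close> plus a
  constant, and both have finite integral by the moment hypothesis and the finiteness of P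
  (\<open>distortion_error_singleton_finite\<close>).\<close>

text \<open>The triangle inequality and homogeneity make N convex, and a convex function on an open
  subset of a finite-dimensional space is continuous. N is an arbitrary norm, not the built-in one
  that defines the topology of the type.\<close>

lemma is_norm_continuous:
  fixes N :: "'a::euclidean_space \<Rightarrow> real"
  assumes "is_norm N"
  shows "continuous_on UNIV N"
proof (rule convex_on_continuous)
  have scale: "N (c *\<^sub>R x) = \<bar>c\<bar> * N x" for c x
    using assms unfolding is_norm_def by blast
  show "convex_on UNIV N"
  proof (rule convex_onI)
    fix t :: real and x y :: 'a
    assume t: "0 < t" "t < 1"
    have "N ((1 - t) *\<^sub>R x + t *\<^sub>R y) \<le> N ((1 - t) *\<^sub>R x) + N (t *\<^sub>R y)"
      using assms unfolding is_norm_def by blast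
    also have "\<dots> = \<bar>1 - t\<bar> * N x + \<bar>t\<bar> * N y"
      by (simp only: scale)
    finally show "N ((1 - t) *\<^sub>R x + t *\<^sub>R y) \<le> (1 - t) * N x + t * N y"
      using t by simp
  qed simp
qed simp

lemma induced_metric_powr_measurable:
  fixes N :: "'a::euclidean_space \<Rightarrow> real"
  assumes "is_norm N"
  shows "(\<lambda>x. induced_metric N x a powr r) \<in> borel_measurable borel"
proof -
  have [measurable]: "N \<in> borel_measurable borel"
    using is_norm_continuous[OF assms] by (rule borel_measurable_continuous_onI)
  show ?thesis
    unfolding induced_metric_def by measurable
qed

text \<open>Trades the literal least element for \<open>Min\<close>, for which measurability over a
  finite index set is available.\<close>

lemma min_cost_eq_Min:
  assumes "finite \<alpha>" "\<alpha> \<noteq> {}"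
  shows "min_cost d r \<alpha> x = Min ((\<lambda>a. d x a powr r) ` \<alpha>)"
  unfolding min_cost_def using assms
  by (intro Least_equality) auto

text \<open>The sum is at most twice the larger term, whose power is one of the two summands on the
  right. This avoids convexity of the power function, so r < 1 and r \<ge> 1 are treated
  alike.\<close>

lemma add_powr_le:
  fixes u v r :: real
  assumes "0 \<le> u" "0 \<le> v" "0 \<le> r"
  shows "(u + v) powr r \<le> 2 powr r * (u powr r + v powr r)"
proof -
  have "(u + v) powr r \<le> (2 * max u v) powr r"
    using assms by (intro powr_mono2) auto
  also have "\<dots> = 2 powr r * max u v powr r"
    using assms by (simp add: powr_mult)
  also have "max u v powr r \<le> u powr r + v powr r"
    by (simp add: max_def)
  finally show ?thesis
    by simp
qed

lemma competitorsD:
  assumes "\<alpha> \<in> competitors S n"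
  shows "finite \<alpha>" "\<alpha> \<noteq> {}"
  using assms by (auto simp: competitors_def intro: card_ge_0_finite)

lemma singleton_in_competitors:
  assumes "a \<in> S" "1 \<le> n"
  shows "{a} \<in> competitors S n"
  using assms by (simp add: competitors_def)

lemma competitors_mono:
  assumes "n \<le> m"
  shows "competitors S n \<subseteq> competitors S m"
  using assms by (auto simp: competitors_def)

lemma constrained_quantization_error_antimono:
  assumes "n \<le> m"
  shows "constrained_quantization_error d r S P m \<le> constrained_quantization_error d r S P n"
  unfolding constrained_quantization_error_def
  using competitors_mono[OF assms] by (rule INF_superset_mono) simp

lemma constrained_quantization_error_existsI:
  fixes N :: "'a::euclidean_space \<Rightarrow> real"
  assumes N: "is_norm N" and P: "sets P = sets borel" and "S \<noteq> {}" "1 \<le> n"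
  shows "constrained_quantization_error_exists (induced_metric N) r S P n"
  unfolding constrained_quantization_error_exists_def
proof (intro conjI ballI allI)
  obtain a where "a \<in> S"
    using assms(3) by blast
  then have "{a} \<in> competitors S n"
    using assms(4) by (rule singleton_in_competitors)
  then show "competitors S n \<noteq> {}"
    by force
next
  fix \<alpha> x
  assume "\<alpha> \<in> competitors S n"
  note \<alpha> = competitorsD[OF this]
  show "\<exists>a\<in>\<alpha>. \<forall>b\<in>\<alpha>. induced_metric N x a powr r \<le> induced_metric N x b powr r"
    \<comment> \<open>A minimizer on a finite set comes as a point with no strictly smaller value;
      linearity of the order turns this into \<le>.\<close>
    using arg_min_if_finite[OF \<alpha>, of "\<lambda>a. induced_metric N x a powr r"]
    by (meson not_le)
next
  fix \<alpha>
  assume "\<alpha> \<in> competitors S n"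
  note \<alpha> = competitorsD[OF this]
  have "(\<lambda>x. induced_metric N x a powr r) \<in> borel_measurable P" for a
    using induced_metric_powr_measurable[OF N] P by (simp cong: measurable_cong_sets)
  then have "(\<lambda>x. Min ((\<lambda>a. induced_metric N x a powr r) ` \<alpha>)) \<in> borel_measurable P"
    by (intro borel_measurable_Min \<alpha>)
  then show "min_cost (induced_metric N) r \<alpha> \<in> borel_measurable P"
    by (simp add: min_cost_eq_Min[OF \<alpha>, abs_def])
qed

lemma distortion_error_singleton_finite:
  fixes N :: "'a::euclidean_space \<Rightarrow> real"
  assumes N: "is_norm N" and r: "0 \<le> r"
    and P: "finite_measure P" "sets P = sets borel"
    and moment: "(\<integral>\<^sup>+ x. ennreal (induced_metric N x 0 powr r) \<partial>P) < \<infinity>"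
  shows "distortion_error (induced_metric N) r P {a} < \<infinity>"
proof -
  interpret finite_measure P by fact
  have N_ge0: "0 \<le> N x" for x
    using N by (simp add: is_norm_def)
  have N_minus: "N (x - a) \<le> N x + N a" for x
  proof -
    \<comment> \<open>The difference is written with the scalar -1 so that homogeneity gives
      \<open>N (- a) = N a\<close>.\<close>
    have "N (x + (- 1) *\<^sub>R a) \<le> N x + N ((- 1) *\<^sub>R a)"
      using N unfolding is_norm_def by blast
    moreover have "N ((- 1) *\<^sub>R a) = \<bar>- 1\<bar> * N a"
      using N unfolding is_norm_def by blast
    ultimately show ?thesis by simp
  qed
  have meas [measurable]: "(\<lambda>x. N x powr r) \<in> borel_measurable P"
    using induced_metric_powr_measurable[OF N, of 0 r] P
    by (simp add: induced_metric_def cong: measurable_cong_sets)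
  have bound: "N (x - a) powr r \<le> 2 powr r * (N x powr r + N a powr r)" for x
  proof -
    have "N (x - a) powr r \<le> (N x + N a) powr r"
      using N_minus N_ge0 r by (intro powr_mono2)
    also have "\<dots> \<le> 2 powr r * (N x powr r + N a powr r)"
      using N_ge0 r by (intro add_powr_le)
    finally show ?thesis .
  qed
  have "distortion_error (induced_metric N) r P {a} = (\<integral>\<^sup>+ x. ennreal (N (x - a) powr r) \<partial>P)"
    by (simp add: distortion_error_def min_cost_eq_Min induced_metric_def)
  also have "\<dots> \<le> (\<integral>\<^sup>+ x. ennreal (2 powr r) * (ennreal (N x powr r) + ennreal (N a powr r)) \<partial>P)"
    \<comment> \<open>The right-hand side is folded back into one \<open>ennreal\<close> of a real,
      which reduces the claim to the real inequality \<open>bound\<close>.\<close>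
    using bound by (intro nn_integral_mono) (simp flip: ennreal_plus ennreal_mult)
  also have "\<dots> = ennreal (2 powr r) *
      ((\<integral>\<^sup>+ x. ennreal (N x powr r) \<partial>P) + ennreal (N a powr r) * emeasure P (space P))"
    by (simp add: nn_integral_cmult nn_integral_add)
  also have "\<dots> < \<infinity>"
    \<comment> \<open>The first integral is the moment about 0; the constant contributes a real
      multiple of the total mass of P, which is finite.\<close>
    using moment
    by (simp add: induced_metric_def ennreal_mult_eq_top_iff flip: less_top)
  finally show ?thesis .
qed

theorem proposition1p1:
  fixes N :: "real ^ 'k \<Rightarrow> real"
    and r :: real
    and S :: "(real ^ 'k) set"
    and P :: "(real ^ 'k) measure"
  assumes "is_norm N"
    and "0 < r"
    and "S \<noteq> {}"
    and "closed S"
    and "prob_space P"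
    and "sets P = sets borel"
    and "(\<integral>\<^sup>+ x. ennreal (induced_metric N x 0 powr r) \<partial>P) < \<infinity>"
  shows "(\<forall>n\<ge>1.
            constrained_quantization_error_exists (induced_metric N) r S P n \<and>
            0 \<le> constrained_quantization_error (induced_metric N) r S P n \<and>
            constrained_quantization_error (induced_metric N) r S P n < \<infinity>) \<and>
         (\<forall>m n. 1 \<le> n \<longrightarrow> n < m \<longrightarrow>
            constrained_quantization_error (induced_metric N) r S P m
              \<le> constrained_quantization_error (induced_metric N) r S P n)"
proof (intro conjI allI impI)
  fix n :: nat
  assume n: "1 \<le> n"
  show "constrained_quantization_error_exists (induced_metric N) r S P n"
    using assms n by (intro constrained_quantization_error_existsI)
  obtain a where "a \<in> S"
    using assms(3) by blast
  then have "constrained_quantization_error (induced_metric N) r S P n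
      \<le> distortion_error (induced_metric N) r P {a}"
    unfolding constrained_quantization_error_def
    using n by (intro INF_lower singleton_in_competitors)
  also have "\<dots> < \<infinity>"
    using assms prob_space.finite_measure by (intro distortion_error_singleton_finite) auto
  finally show "constrained_quantization_error (induced_metric N) r S P n < \<infinity>" .
\<comment> \<open>What remains is nonnegativity, automatic in \<open>ennreal\<close>, and
  monotonicity in n.\<close>
qed (auto intro: constrained_quantization_error_antimono)

end
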